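(* If $Y\subset\mathbb{R}^p$ is closed and convex and $Y_N\neq\emptyset$, then $Y$ is $\mathbb{R}^p_{\geqq}$-compact.
   Context: For $a,b\in\mathbb{R}^p$: $a\leqq b$ means $a_j\le b_j$ for every $j$; $a\leq b$ means $a\leqq b$ and $a\neq b$. Let $\mathbb{R}^p_{\geqq}=\{y\in\mathbb{R}^p: y_j\ge 0\ \text{for every } j\}$. For $Y\subseteq\mathbb{R}^p$, a point $y^0\in Y$ is nondominated if there is no $y\in Y$ with $y\leq y^0$; $Y_N$ denotes the set of all nondominated points of $Y$. A set $Y\subseteq\mathbb{R}^p$ is called $\mathbb{R}^p_{\geqq}$-compact if $(y-\mathbb{R}^p_{\geqq})\cap Y$ is compact for every $y\in Y$. *)

theory Defs
  imports "HOL-Analysis.Analysis"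
begin

(* The library order on real ^ 'p is componentwise (less_eq_vec_def), so "a \<le> b" below is
   the weak order "a \<leqq> b" of the source; its order "a \<le> b" is "a \<le> b \<and> a \<noteq> b" here. *)

definition nonneg_orthant :: "(real ^ 'p) set" where
  "nonneg_orthant = {y. \<forall>j. 0 \<le> y $ j}"

definition nondominated :: "(real ^ 'p) set \<Rightarrow> (real ^ 'p) set" where
  "nondominated Y = {y0 \<in> Y. \<not> (\<exists>y\<in>Y. y \<le> y0 \<and> y \<noteq> y0)}"

definition orthant_compact :: "(real ^ 'p) set \<Rightarrow> bool" where
  "orthant_compact Y \<longleftrightarrow> (\<forall>y\<in>Y. compact ((\<lambda>z. y - z) ` nonneg_orthant \<inter> Y))"

end

theory Submission
  imports Defs
begin

text \<open>If the part of \<open>Y\<close> below some point were unbounded, normalising a sequence in it that tends to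
  infinity would give a direction \<open>d \<noteq> 0\<close> with \<open>d \<le> 0\<close>. Since \<open>Y\<close> is closed and convex, such an
  asymptotic direction can be followed from every point of \<open>Y\<close>, so \<open>y0 + d \<in> Y\<close> for each \<open>y0 \<in> Y\<close>,
  and no point of \<open>Y\<close> is nondominated.\<close>

text \<open>Compactness of the unit sphere makes a subsequence of normalised, ever longer points of
  \<open>S\<close> converge to \<open>d\<close>. The sequence \<open>z\<close> is returned together
  with \<open>d\<close> because order information on \<open>S\<close> passes to \<open>d\<close>
  only through that limit.\<close>

lemma unbounded_subset_imp_direction:
  fixes Y S :: "'a::euclidean_space set"
  assumes "closed Y" "convex Y" "S \<subseteq> Y" "\<not> bounded S"
  obtains z d where "\<And>n::nat. z n \<in> S" "filterlim (\<lambda>n. norm (z n)) at_top sequentially"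
    "(\<lambda>n. z n /\<^sub>R norm (z n)) \<longlonglongrightarrow> d" "norm d = 1" "\<And>y. y \<in> Y \<Longrightarrow> y + d \<in> Y"
proof -
  \<comment> \<open>The \<open>+ 1\<close> keeps every norm above 1, so that each point can be
    normalised and the inverse of its norm can serve as a convex weight below.\<close>
  have "\<exists>x\<in>S. norm x > real n + 1" for n :: nat
    using \<open>\<not> bounded S\<close> unfolding bounded_iff by (meson not_le)
  then obtain x where x: "\<And>n. x n \<in> S" "\<And>n. norm (x n) > real n + 1"
    by metis
  define u where "u n = x n /\<^sub>R norm (x n)" for n
  have nz: "x n \<noteq> 0" for n
    using x(2)[of n] by auto
  have "u n \<in> sphere 0 1" for n
    using nz by (simp add: u_def)
  then obtain d r where d: "d \<in> sphere 0 1" and r: "strict_mono r" and ud: "(u \<circ> r) \<longlonglongrightarrow> d"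
    using compact_sphere[of "0::'a" 1] unfolding compact_def by metis
  have "filterlim (\<lambda>n. norm (x n)) at_top sequentially"
  proof (rule filterlim_at_top_mono[OF filterlim_real_sequentially])
    show "\<forall>\<^sub>F n in sequentially. real n \<le> norm (x n)"
      by (rule always_eventually) (smt (verit) x(2))
  qed
  from filterlim_compose[OF this filterlim_subseq[OF r]]
  have lim: "filterlim (\<lambda>n. norm (x (r n))) at_top sequentially" .
  have ud': "(\<lambda>n. x (r n) /\<^sub>R norm (x (r n))) \<longlonglongrightarrow> d"
    using ud by (simp add: u_def o_def)
  show ?thesis
  proof (rule that[of "\<lambda>n. x (r n)" d])
    show "y + d \<in> Y" if y: "y \<in> Y" for y
    proof (rule closed_sequentially[OF \<open>closed Y\<close>])
      let ?t = "\<lambda>n. inverse (norm (x (r n)))"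
      \<comment> \<open>With the weight \<open>?t n\<close> the second summand is exactly the
        normalised point, which tends to \<open>d\<close>, while the coefficient of \<open>y\<close>
        tends to 1.\<close>
      show "(1 - ?t n) *\<^sub>R y + ?t n *\<^sub>R x (r n) \<in> Y" for n
      proof (rule convexD_alt[OF \<open>convex Y\<close> y])
        show "x (r n) \<in> Y"
          using x(1) \<open>S \<subseteq> Y\<close> by auto
        show "?t n \<le> 1"
          using x(2)[of "r n"] by (intro inverse_le_1_iff[THEN iffD2] disjI2) simp
      qed simp
      have "?t \<longlonglongrightarrow> 0"
        using lim by (rule tendsto_inverse_0_at_top)
      then have "(\<lambda>n. (1 - ?t n) *\<^sub>R y + ?t n *\<^sub>R x (r n)) \<longlonglongrightarrow> (1 - 0) *\<^sub>R y + d"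
        by (intro tendsto_intros ud')
      then show "(\<lambda>n. (1 - ?t n) *\<^sub>R y + ?t n *\<^sub>R x (r n)) \<longlonglongrightarrow> y + d"
        by simp
    qed
  qed (use x(1) lim ud' d in auto)
qed

lemma diff_nonneg_orthant_eq: "(\<lambda>z. y - z) ` nonneg_orthant = {..y}"
proof
  show "{..y} \<subseteq> (\<lambda>z. y - z) ` nonneg_orthant"
  proof
    fix w assume "w \<in> {..y}"
    then have "w = y - (y - w)" "y - w \<in> nonneg_orthant"
      by (auto simp: nonneg_orthant_def less_eq_vec_def)
    then show "w \<in> (\<lambda>z. y - z) ` nonneg_orthant"
      by blast
  qed
qed (auto simp: nonneg_orthant_def less_eq_vec_def)

theorem lemma4p3:
  fixes Y :: "(real ^ 'p) set"
  assumes "closed Y" and "convex Y" and "nondominated Y \<noteq> {}"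
  shows "orthant_compact Y"
  unfolding orthant_compact_def diff_nonneg_orthant_eq
proof
  fix y assume "y \<in> Y"
  obtain y0 where y0: "y0 \<in> Y" "\<And>w. w \<in> Y \<Longrightarrow> w \<le> y0 \<Longrightarrow> w = y0"
    using \<open>nondominated Y \<noteq> {}\<close> by (auto simp: nondominated_def)
  have "bounded ({..y} \<inter> Y)"
  proof (rule ccontr)
    assume "\<not> bounded ({..y} \<inter> Y)"
    then obtain z d where z: "\<And>n::nat. z n \<in> {..y} \<inter> Y"
      and lim: "filterlim (\<lambda>n. norm (z n)) at_top sequentially"
      and zd: "(\<lambda>n. z n /\<^sub>R norm (z n)) \<longlonglongrightarrow> d" and d: "norm d = 1" "\<And>w. w \<in> Y \<Longrightarrow> w + d \<in> Y"
      using unbounded_subset_imp_direction[OF assms(1,2), of "{..y} \<inter> Y"] by auto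
    \<comment> \<open>Coordinate \<open>j\<close> of every \<open>z n\<close> is at most the fixed
      number \<open>y $ j\<close>; after division by a norm tending to infinity, this upper bound
      tends to 0.\<close>
    have "d $ j \<le> 0" for j
    proof (rule LIMSEQ_le)
      show "(\<lambda>n. (z n /\<^sub>R norm (z n)) $ j) \<longlonglongrightarrow> d $ j"
        by (intro tendsto_intros zd)
      have "(\<lambda>n. inverse (norm (z n)) * y $ j) \<longlonglongrightarrow> 0 * y $ j"
        by (intro tendsto_intros tendsto_inverse_0_at_top lim)
      then show "(\<lambda>n. inverse (norm (z n)) * y $ j) \<longlonglongrightarrow> 0"
        by simp
      have "z n $ j \<le> y $ j" for n
        using z[of n] by (simp add: less_eq_vec_def)
      then show "\<exists>N. \<forall>n\<ge>N. (z n /\<^sub>R norm (z n)) $ j \<le> inverse (norm (z n)) * y $ j"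
        by (simp add: mult_left_mono)
    qed
    then have "y0 + d \<le> y0"
      by (simp add: less_eq_vec_def)
    \<comment> \<open>\<open>y0 + d\<close> lies in \<open>Y\<close> and below \<open>y0\<close>, so
      nondominance forces \<open>y0 + d = y0\<close>.\<close>
    then have "d = 0"
      using y0 d(2) by fastforce
    with d(1) show False
      by simp
  qed
  moreover have "closed ({..y} \<inter> Y)"
  proof -
    have "{..y} = (\<Inter>j. {w. w $ j \<le> y $ j})"
      by (auto simp: less_eq_vec_def)
    then have "closed {..y}"
      by (auto intro!: closed_INT closed_Collect_le continuous_intros)
    then show ?thesis
      using \<open>closed Y\<close> by blast
  qed
  ultimately show "compact ({..y} \<inter> Y)"
    by (simp add: compact_eq_bounded_closed)
qed

end
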